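(* Let $X$ be a Banach space, let $C\subseteq X$ be a closed, bounded, convex, non-singleton, non-empty set, and let $\mathcal{M}=\mathcal{M}(C)$ denote the space of non-expansive mappings $C\to C$ equipped with the supremum metric. Let $K>1$ and let $\phi,\xi\colon(0,1/K)\to(0,\infty)$ be strictly increasing concave functions satisfying $$\phi(t)\xi(t)\geq \frac{t}{K}\ \text{ for all }t\in(0,1/K)\quad\text{ and }\quad\lim_{t\to 0}\xi(t)=0.$$ Then there is a $\sigma$-$\xi$-lower porous subset $\mathcal{N}$ of $\mathcal{M}$ such that for every mapping $f\in \mathcal{M}\setminus \mathcal{N}$ the set $$R(f):=\{x\in C\colon \operatorname{Lip}(f,x)=1\}$$ is the complement (in $C$) of a $\sigma$-$\phi$-upper porous subset of $C$.
   Context: A mapping $f\colon C\to C$ is non-expansive if $\|f(y)-f(x)\|\le\|y-x\|$ for all $x,y\in C$. $\mathcal{M}(C)$ is the set of all non-expansive mappings $C\to C$, with metric $d_\infty(f,g)=\|g-f\|_\infty=\sup_{x\in C}\|g(x)-f(x)\|$. For $f\colon C\to C$ and $x\in C$, $$\operatorname{Lip}(f,x):=\lim_{r\to 0}\sup\left\{\frac{\|f(y)-f(x)\|}{\|y-x\|}\colon y\in C,\ 0<\|y-x\|\le r\right\}.$$ Porosity: let $(M,d)$ be a metric space, $P\subseteq M$, $x\in M$, $\eta>0$ and $\phi\colon(0,\eta)\to(0,\infty)$ increasing. Let $B_M(x,r)$ be the open ball and, for $r>0$, $$\gamma(x,r,P):=\sup\{s>0\colon \exists x'\in M\text{ such that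 }B_M(x',s)\subseteq B_M(x,r)\setminus P\},$$ with $\sup\emptyset=-\infty$. $P$ is $\phi$-upper porous at $x$ if $\gamma(x,r,P)>0$ for all $r>0$ and $\limsup_{r\to 0}\phi(\gamma(x,r,P))/r>0$; it is $\phi$-lower porous at $x$ if $\gamma(x,r,P)>0$ for all $r>0$ and $\liminf_{r\to 0}\phi(\gamma(x,r,P))/r>0$. $P$ is $\phi$-upper (lower) porous if it is $\phi$-upper (lower) porous at every $x\in P$. A set is $\sigma$-$\phi$-upper (lower) porous if it is a countable union of $\phi$-upper (lower) porous sets. The same definitions are used with $\xi$ in place of $\phi$. Subsets of $C$ are considered in the metric space $C$ with the metric induced by the norm. *)

theory Defs
  imports "HOL-Analysis.Analysis"
begin

context Metric_space
begin

definition porosity_gap :: "'a \<Rightarrow> real \<Rightarrow> 'a set \<Rightarrow> ereal" where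
  "porosity_gap x r P =
     Sup {ereal s | s. s > 0 \<and> (\<exists>x'\<in>M. mball x' s \<subseteq> mball x r - P)}"

text \<open>
  A gauge \<open>\<phi> : (0,\<eta>) \<rightarrow> (0,\<infinity>)\<close> is represented by a total function; only its values on
  \<open>(0,\<eta>)\<close> are meant to matter. If \<open>M\<close> is a convex set with at least two points in a normed space,
  then the gap at radius \<open>r\<close> is at most \<open>2 r\<close> for all small \<open>r\<close>, so along \<open>r \<rightarrow> 0\<close> a positive
  gap is a real number in \<open>(0,\<eta>)\<close>, and neither the conversion to \<open>real\<close> nor the values
  of \<open>\<phi>\<close> outside \<open>(0,\<eta>)\<close> play a role.
\<close>

definition upper_porous_at :: "(real \<Rightarrow> real) \<Rightarrow> 'a set \<Rightarrow> 'a \<Rightarrow> bool" where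
  "upper_porous_at \<phi> P x \<longleftrightarrow>
     (\<forall>r>0. porosity_gap x r P > 0) \<and>
     Limsup (at_right 0) (\<lambda>r. ereal (\<phi> (real_of_ereal (porosity_gap x r P)) / r)) > 0"

definition lower_porous_at :: "(real \<Rightarrow> real) \<Rightarrow> 'a set \<Rightarrow> 'a \<Rightarrow> bool" where
  "lower_porous_at \<phi> P x \<longleftrightarrow>
     (\<forall>r>0. porosity_gap x r P > 0) \<and>
     Liminf (at_right 0) (\<lambda>r. ereal (\<phi> (real_of_ereal (porosity_gap x r P)) / r)) > 0"

definition upper_porous :: "(real \<Rightarrow> real) \<Rightarrow> 'a set \<Rightarrow> bool" where
  "upper_porous \<phi> P \<longleftrightarrow> P \<subseteq> M \<and> (\<forall>x\<in>P. upper_porous_at \<phi> P x)"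

definition lower_porous :: "(real \<Rightarrow> real) \<Rightarrow> 'a set \<Rightarrow> bool" where
  "lower_porous \<phi> P \<longleftrightarrow> P \<subseteq> M \<and> (\<forall>x\<in>P. lower_porous_at \<phi> P x)"

definition sigma_upper_porous :: "(real \<Rightarrow> real) \<Rightarrow> 'a set \<Rightarrow> bool" where
  "sigma_upper_porous \<phi> P \<longleftrightarrow>
     (\<exists>\<Q>. countable \<Q> \<and> (\<forall>Q\<in>\<Q>. upper_porous \<phi> Q) \<and> P = \<Union>\<Q>)"

definition sigma_lower_porous :: "(real \<Rightarrow> real) \<Rightarrow> 'a set \<Rightarrow> bool" where
  "sigma_lower_porous \<phi> P \<longleftrightarrow>
     (\<exists>\<Q>. countable \<Q> \<and> (\<forall>Q\<in>\<Q>. lower_porous \<phi> Q) \<and> P = \<Union>\<Q>)"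

end

text \<open>
  Mappings \<open>C \<rightarrow> C\<close> are taken extensional, so that equality of mappings is equality on \<open>C\<close>
  and the supremum distance separates points.
\<close>

definition nonexpansive_maps :: "'a::real_normed_vector set \<Rightarrow> ('a \<Rightarrow> 'a) set" where
  "nonexpansive_maps C =
     {f \<in> C \<rightarrow>\<^sub>E C. \<forall>x\<in>C. \<forall>y\<in>C. norm (f y - f x) \<le> norm (y - x)}"

text \<open>
  The locale \<open>Metric_space\<close> requires nonnegativity and symmetry of the distance on the whole type,
  hence the value \<open>0\<close> off the space, where the supremum over \<open>C\<close> need not exist.
\<close>

definition sup_dist ::
  "'a::real_normed_vector set \<Rightarrow> ('a \<Rightarrow> 'a) \<Rightarrow> ('a \<Rightarrow> 'a) \<Rightarrow> real" where
  "sup_dist C f g =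
     (if f \<in> nonexpansive_maps C \<and> g \<in> nonexpansive_maps C
      then SUP x\<in>C. norm (g x - f x) else 0)"

definition Lip_at :: "'a::real_normed_vector set \<Rightarrow> ('a \<Rightarrow> 'a) \<Rightarrow> 'a \<Rightarrow> ereal" where
  "Lip_at C f x =
     Lim (at_right 0) (\<lambda>r. Sup {ereal (norm (f y - f x) / norm (y - x)) | y.
       y \<in> C \<and> 0 < norm (y - x) \<and> norm (y - x) \<le> r})"

definition Lip_one_set :: "'a::real_normed_vector set \<Rightarrow> ('a \<Rightarrow> 'a) \<Rightarrow> 'a set" where
  "Lip_one_set C f = {x \<in> C. Lip_at C f x = 1}"

lemma Metric_space_subset: "Metric_space (C :: 'a::metric_space set) dist"
  by (unfold_locales) (auto simp: dist_commute dist_triangle)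

lemma Metric_space_nonexpansive_maps:
  fixes C :: "'a::real_normed_vector set"
  assumes "bounded C" "C \<noteq> {}"
  shows "Metric_space (nonexpansive_maps C) (sup_dist C)"
proof -
  obtain b where b: "\<And>x y. x \<in> C \<Longrightarrow> y \<in> C \<Longrightarrow> norm (y - x) \<le> b"
    using assms(1) unfolding bounded_two_points by (metis dist_norm)
  obtain c where c: "c \<in> C" using assms(2) by blast
  let ?N = "nonexpansive_maps C"
  have bdd: "bdd_above ((\<lambda>x. norm (g x - f x)) ` C)" if "f \<in> ?N" "g \<in> ?N" for f g
    using that by (intro bdd_aboveI2[where M = b]) (auto simp: nonexpansive_maps_def PiE_iff intro!: b)
  have le: "norm (g x - f x) \<le> sup_dist C f g" if "f \<in> ?N" "g \<in> ?N" "x \<in> C" for f g x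
    using that cSUP_upper[OF that(3) bdd[OF that(1,2)]] by (simp add: sup_dist_def)
  have lub: "sup_dist C f g \<le> B"
    if "f \<in> ?N" "g \<in> ?N" "\<And>x. x \<in> C \<Longrightarrow> norm (g x - f x) \<le> B" for f g B
    using that cSUP_least[OF assms(2), of "\<lambda>x. norm (g x - f x)" B] by (simp add: sup_dist_def)
  show ?thesis
  proof
    fix f g
    show "0 \<le> sup_dist C f g"
    proof (cases "f \<in> ?N \<and> g \<in> ?N")
      case True
      then show ?thesis
        using le[of f g c] c norm_ge_zero[of "g c - f c"] by linarith
    qed (auto simp: sup_dist_def)
    show "sup_dist C f g = sup_dist C g f"
      by (simp add: sup_dist_def norm_minus_commute)
  next
    fix f g assume fg: "f \<in> ?N" "g \<in> ?N"
    show "sup_dist C f g = 0 \<longleftrightarrow> f = g"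
    proof
      assume "sup_dist C f g = 0"
      then have "f x = g x" if "x \<in> C" for x
        using le[OF fg that] by simp
      then show "f = g"
        using fg unfolding nonexpansive_maps_def by (auto intro: PiE_ext)
    next
      assume "f = g"
      then show "sup_dist C f g = 0"
        using assms(2) by (simp add: sup_dist_def)
    qed
  next
    fix f g h assume *: "f \<in> ?N" "g \<in> ?N" "h \<in> ?N"
    show "sup_dist C f h \<le> sup_dist C f g + sup_dist C g h"
    proof (rule lub[OF *(1,3)])
      fix x assume "x \<in> C"
      have "norm (h x - f x) \<le> norm (g x - f x) + norm (h x - g x)"
        using norm_triangle_ineq[of "g x - f x" "h x - g x"] by simp
      then show "norm (h x - f x) \<le> sup_dist C f g + sup_dist C g h"
        using le[OF *(1,2) \<open>x \<in> C\<close>] le[OF *(2,3) \<open>x \<in> C\<close>] by linarith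
    qed
  qed
qed

end

theory Submission
  imports Defs
begin

text \<open>
  The points where the local Lipschitz constant of \<open>f\<close> is less than 1 form the union over \<open>\<epsilon> = 1/n\<close>
  of the sets of points \<open>x\<close> such that \<open>f\<close> contracts by the factor \<open>1 - \<epsilon>\<close> all distances up to \<open>\<epsilon>\<close>
  from \<open>x\<close>.

  Replacing \<open>f\<close> by \<open>(1 - r) f + r a\<close> gives room for precomposition with maps of Lipschitz constant
  \<open>1 / (1 - r)\<close>. Such a map can collapse a ball of radius \<open>s = r \<rho>\<close> to its centre while being the
  identity outside the concentric ball of radius \<open>\<rho>\<close>. Where the composition is constant there is
  space for a spike of height \<open>s\<close> with slope 1. Doing this around all points of a maximal
  \<open>2 \<rho>\<close>-separated set yields a map at distance of order \<open>r\<close> from \<open>f\<close>. The steep spikes are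
  still visible, for every map within \<open>\<sigma> \<approx> \<epsilon> s\<close> of it, from all points of
  the \<open>\<sigma>\<close>-balls around the centres. So the exceptional set of each such map has holes of radius \<open>\<sigma>\<close>
  at distance at most \<open>2 \<rho>\<close> from every point.

  Choose \<open>\<sigma>\<close> with \<open>\<xi> \<sigma> = c r\<close>. Then \<open>\<phi> \<sigma> \<ge> \<sigma> / (K c r)\<close>, which is of order \<open>\<rho>\<close>, and since
  \<open>\<sigma> / \<xi> \<sigma>\<close> is bounded by concavity, \<open>\<rho>\<close> is as small as desired once \<open>c\<close> is small. Decreasing \<open>c\<close>
  costs only in the \<open>\<xi>\<close>-porosity constant of the discarded maps, never in the \<open>\<phi>\<close>-porosity constant.
\<close>

subsection \<open>Porosity criteria\<close>

context Metric_space
begin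

lemma porosity_gap_ge:
  assumes "s > 0" "x' \<in> M" "mball x' s \<subseteq> mball x r - P"
  shows "ereal s \<le> porosity_gap x r P"
  unfolding porosity_gap_def using assms by (intro Sup_upper) blast

lemma porosity_gap_mono:
  assumes "r \<le> r'"
  shows "porosity_gap x r P \<le> porosity_gap x r' P"
  unfolding porosity_gap_def using mball_subset_concentric[OF assms, of x]
  by (intro Sup_subset_mono) blast

text \<open>A hole in the ball has its centre within \<open>r\<close> of \<open>x\<close> and misses
  \<open>z\<close>, which lies on the sphere; so its radius is at most the distance from its centre
  to \<open>z\<close>, less than \<open>2 * r\<close>.\<close>

lemma porosity_gap_le:
  assumes "x \<in> M" "z \<in> M" "d x z = r"
  shows "porosity_gap x r P \<le> ereal (2 * r)"
  unfolding porosity_gap_def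
proof (rule Sup_least, clarify)
  fix s x' assume s: "(s::real) > 0" "x' \<in> M" "mball x' s \<subseteq> mball x r - P"
  then have "x' \<in> mball x r"
    by (metis DiffE centre_in_mball_iff subsetD)
  moreover have "z \<notin> mball x' s"
    using s(3) assms(3) by auto
  ultimately show "ereal s \<le> ereal (2 * r)"
    using assms s(2) triangle[of x' x z] by (simp add: commute)
qed

text \<open>The gap lies between \<open>s\<close> and \<open>2 * r\<close>, so it is a real number
  inside \<open>(0,\<eta>)\<close>, where \<open>\<phi>\<close> is monotone.\<close>

lemma gauge_porosity_gap_ge:
  fixes \<phi> :: "real \<Rightarrow> real"
  assumes \<phi>: "strict_mono_on {0<..<\<eta>} \<phi>"
    and x: "x \<in> M" "z \<in> M" "d x z = r" "2 * r < \<eta>"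
    and s: "s > 0" "x' \<in> M" "mball x' s \<subseteq> mball x r - P"
  shows "\<phi> s \<le> \<phi> (real_of_ereal (porosity_gap x r P))"
proof -
  let ?\<gamma> = "porosity_gap x r P"
  have "ereal s \<le> ?\<gamma>" "?\<gamma> \<le> ereal (2 * r)"
    by (rule porosity_gap_ge[OF s] porosity_gap_le[OF x(1-3)])+
  then obtain u where u: "?\<gamma> = ereal u" "s \<le> u" "u \<le> 2 * r"
    by (cases ?\<gamma>) auto
  then show ?thesis
    using s x strict_mono_on_leD[OF \<phi>, of s u] by simp
qed

lemma porosity_gap_pos:
  assumes "\<exists>\<rho>\<in>{0<..<r}. \<exists>s>0. \<exists>x'\<in>M. mball x' s \<subseteq> mball x \<rho> - P"
  shows "porosity_gap x r P > 0"
proof -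
  obtain \<rho> s x' where *: "\<rho> \<in> {0<..<r}" "(s::real) > 0" "x' \<in> M" "mball x' s \<subseteq> mball x \<rho> - P"
    using assms by blast
  have "0 < ereal s" using *(2) by simp
  also have "\<dots> \<le> porosity_gap x \<rho> P" using porosity_gap_ge[OF *(2-4)] .
  also have "\<dots> \<le> porosity_gap x r P" using *(1) by (intro porosity_gap_mono) auto
  finally show ?thesis .
qed

lemma lower_porous_atI:
  assumes \<phi>: "strict_mono_on {0<..<\<eta>} \<phi>" and "\<eta> > 0" "c > 0" "r0 > 0" and x: "x \<in> M"
    and sphere: "\<And>r. r \<in> {0<..<r0} \<Longrightarrow> \<exists>z\<in>M. d x z = r"
    and hole: "\<And>r. r \<in> {0<..<r0} \<Longrightarrow> \<exists>s>0. c * r \<le> \<phi> s \<and> (\<exists>x'\<in>M. mball x' s \<subseteq> mball x r - P)"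
  shows "lower_porous_at \<phi> P x"
  unfolding lower_porous_at_def
proof (intro conjI allI impI)
  fix r :: real assume "r > 0"
  then have "min r r0 / 2 \<in> {0<..<r}" "min r r0 / 2 \<in> {0<..<r0}"
    using \<open>r0 > 0\<close> by auto
  then show "porosity_gap x r P > 0"
    using hole by (intro porosity_gap_pos) blast
next
  have "\<forall>\<^sub>F r in at_right 0. r \<in> {0<..<min r0 (\<eta>/2)}"
    using assms by (intro eventually_at_right_real) auto
  then have "\<forall>\<^sub>F r in at_right 0. ereal c \<le> ereal (\<phi> (real_of_ereal (porosity_gap x r P)) / r)"
  proof eventually_elim
    case (elim r)
    then obtain z s x' where "z \<in> M" "d x z = r" and
      s: "s > 0" "c * r \<le> \<phi> s" "x' \<in> M" "mball x' s \<subseteq> mball x r - P"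
      using sphere[of r] hole[of r] by auto
    then have "\<phi> s \<le> \<phi> (real_of_ereal (porosity_gap x r P))"
      using elim x by (intro gauge_porosity_gap_ge[OF \<phi>, of x z r s x']) auto
    then show ?case
      using s elim by (simp add: le_divide_eq)
  qed
  then have "ereal c \<le> Liminf (at_right 0) (\<lambda>r. ereal (\<phi> (real_of_ereal (porosity_gap x r P)) / r))"
    by (rule Liminf_bounded)
  with \<open>c > 0\<close> show "0 < Liminf (at_right 0) (\<lambda>r. ereal (\<phi> (real_of_ereal (porosity_gap x r P)) / r))"
    using less_le_trans[of 0 "ereal c"] by simp
qed

text \<open>If the upper limit were below \<open>c\<close>, so would be the quotient on a whole
  interval next to 0; a hole at a radius in that interval contradicts this.\<close>

lemma upper_porous_atI:
  assumes \<phi>: "strict_mono_on {0<..<\<eta>} \<phi>" and "\<eta> > 0" "c > 0" "r0 > 0" and x: "x \<in> M"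
    and sphere: "\<And>r. r \<in> {0<..<r0} \<Longrightarrow> \<exists>z\<in>M. d x z = r"
    and hole: "\<And>r'. r' > 0 \<Longrightarrow> \<exists>r\<in>{0<..<r'}. \<exists>s>0. c * r \<le> \<phi> s \<and>
                 (\<exists>x'\<in>M. mball x' s \<subseteq> mball x r - P)"
  shows "upper_porous_at \<phi> P x"
  unfolding upper_porous_at_def
proof (intro conjI allI impI)
  fix r :: real assume "r > 0"
  then show "porosity_gap x r P > 0"
    using hole[of r] by (intro porosity_gap_pos) blast
next
  let ?q = "\<lambda>r. ereal (\<phi> (real_of_ereal (porosity_gap x r P)) / r)"
  have "ereal c \<le> Limsup (at_right 0) ?q"
  proof (rule ccontr)
    assume "\<not> ?thesis"
    then have "\<forall>\<^sub>F r in at_right 0. ?q r < ereal c"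
      by (intro Limsup_lessD) auto
    then obtain b where b: "b > 0" "\<And>r. r \<in> {0<..<b} \<Longrightarrow> ?q r < ereal c"
      by (auto simp: eventually_at_right_field)
    obtain r s x' where r: "r \<in> {0<..<min b (min r0 (\<eta>/2))}" and
      s: "s > 0" "c * r \<le> \<phi> s" "x' \<in> M" "mball x' s \<subseteq> mball x r - P"
      using hole[of "min b (min r0 (\<eta>/2))"] b(1) \<open>r0 > 0\<close> \<open>\<eta> > 0\<close> by force
    obtain z where z: "z \<in> M" "d x z = r"
      using sphere[of r] r by auto
    have "\<phi> s \<le> \<phi> (real_of_ereal (porosity_gap x r P))"
      using r s z x by (intro gauge_porosity_gap_ge[OF \<phi>, of x z r s x']) auto
    moreover have "\<phi> (real_of_ereal (porosity_gap x r P)) < c * r"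
      using b(2)[of r] r by (simp add: divide_less_eq)
    ultimately show False using s by simp
  qed
  with \<open>c > 0\<close> show "0 < Limsup (at_right 0) ?q"
    using less_le_trans[of 0 "ereal c"] by simp
qed

end

subsection \<open>Perturbing a non-expansive map by spikes\<close>

lemma convex_sphere_point:
  fixes C :: "'a::real_normed_vector set"
  assumes "convex C" "x \<in> C" "a \<in> C" "0 \<le> t" "t \<le> dist x a"
  shows "\<exists>z\<in>C. dist x z = t"
proof (cases "x = a")
  case True
  then show ?thesis using assms by auto
next
  case False
  define u where "u = t / dist x a"
  have u: "0 \<le> u" "u \<le> 1" using assms False by (auto simp: u_def)
  have "dist x ((1 - u) *\<^sub>R x + u *\<^sub>R a) = norm (u *\<^sub>R (x - a))"
    by (simp add: dist_norm algebra_simps)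
  also have "\<dots> = t"
    using assms(4) False by (simp add: u_def dist_norm)
  finally show ?thesis
    using convexD_alt[OF assms(1-3) u] by blast
qed

lemma far_point:
  fixes a b x :: "'a::metric_space"
  shows "dist a b / 2 \<le> dist x a \<or> dist a b / 2 \<le> dist x b"
  using dist_triangle[of a b x] by (auto simp: dist_commute)

lemma closed_segment_sphere:
  fixes x x' y :: "'a::real_normed_vector"
  assumes "dist x y \<le> \<rho>" "\<rho> \<le> dist x' y"
  shows "\<exists>p\<in>closed_segment x x'. dist p y = \<rho>"
proof -
  have "continuous_on (closed_segment x x') (\<lambda>p. dist p y)"
    by (intro continuous_intros)
  then have "connected ((\<lambda>p. dist p y) ` closed_segment x x')"
    by (intro connected_continuous_image connected_segment)
  then have "\<rho> \<in> (\<lambda>p. dist p y) ` closed_segment x x'"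
    by (rule connectedD_interval[of _ "dist x y" "dist x' y"]) (use assms in auto)
  then show ?thesis by auto
qed

text \<open>Zorn's lemma gives a maximal separated set; a point of \<open>C\<close> at distance at
  least \<open>\<rho>\<close> from all of it could still be added.\<close>

lemma maximal_separated_subset:
  fixes C :: "'a::metric_space set"
  assumes "\<rho> > 0"
  obtains S where "S \<subseteq> C" "\<And>y y'. y \<in> S \<Longrightarrow> y' \<in> S \<Longrightarrow> y \<noteq> y' \<Longrightarrow> \<rho> \<le> dist y y'"
    "\<And>x. x \<in> C \<Longrightarrow> \<exists>y\<in>S. dist x y < \<rho>"
proof -
  define \<A> where "\<A> = {S. S \<subseteq> C \<and> (\<forall>y\<in>S. \<forall>y'\<in>S. y \<noteq> y' \<longrightarrow> \<rho> \<le> dist y y')}"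
  have "\<exists>S\<in>\<A>. \<forall>T\<in>\<A>. S \<subseteq> T \<longrightarrow> T = S"
  proof (rule subset_Zorn_nonempty)
    show "\<A> \<noteq> {}" unfolding \<A>_def by blast
    fix \<C> assume "\<C> \<noteq> {}" and ch: "subset.chain \<A> \<C>"
    then have sub: "\<C> \<subseteq> \<A>" by (simp add: subset.chain_def)
    have "\<rho> \<le> dist y y'" if y: "y \<in> A" "A \<in> \<C>" "y' \<in> B" "B \<in> \<C>" "y \<noteq> y'" for y y' A B
    proof -
      have "A \<subseteq> B \<or> B \<subseteq> A" using ch y by (auto simp: subset.chain_def)
      then show ?thesis using y sub unfolding \<A>_def by blast
    qed
    then show "\<Union>\<C> \<in> \<A>" using sub unfolding \<A>_def by blast
  qed
  then obtain S where S: "S \<in> \<A>" and max: "\<And>T. T \<in> \<A> \<Longrightarrow> S \<subseteq> T \<Longrightarrow> T = S" by blast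
  have "\<exists>y\<in>S. dist x y < \<rho>" if "x \<in> C" for x
  proof (rule ccontr)
    assume no: "\<not> ?thesis"
    then have "insert x S \<in> \<A>"
      using S that unfolding \<A>_def by (auto simp: dist_commute not_less)
    then have "x \<in> S" using max[of "insert x S"] by blast
    then show False using no assms by force
  qed
  moreover have "S \<subseteq> C" "\<And>y y'. y \<in> S \<Longrightarrow> y' \<in> S \<Longrightarrow> y \<noteq> y' \<Longrightarrow> \<rho> \<le> dist y y'"
    using S unfolding \<A>_def by blast+
  ultimately show ?thesis by (rule that[rotated 2])
qed

section \<open>Collapsing a ball and inserting a single spike\<close>

text \<open>
  The map \<open>x \<mapsto> y + \<theta> (\<parallel>x - y\<parallel>) (x - y)\<close> with this \<open>\<theta>\<close> collapses the ball of radius \<open>s\<close> around \<open>y\<close>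
  and fixes everything at distance at least \<open>s / r\<close>. It is \<open>1 / (1 - r)\<close>-Lipschitz in every normed space,
  because \<open>\<theta>\<close> is nondecreasing and \<open>t \<mapsto> t \<theta> t\<close> is \<open>1 / (1 - r)\<close>-Lipschitz.
\<close>

definition collapse_factor :: "real \<Rightarrow> real \<Rightarrow> real \<Rightarrow> real" where
  "collapse_factor r s t = (if t \<le> s then 0 else min t ((t - s) / (1 - r)) / t)"

lemma collapse_factor_bounds:
  assumes "0 < r" "r < 1" "0 < s"
  shows "0 \<le> collapse_factor r s t" "collapse_factor r s t \<le> 1"
  using assms by (auto simp: collapse_factor_def divide_le_eq)

lemma mult_collapse_factor:
  assumes "0 < s" "s < t"
  shows "t * collapse_factor r s t = min t ((t - s) / (1 - r))"
  using assms by (simp add: collapse_factor_def)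

text \<open>Dividing inside the minimum turns the factor into a function of \<open>s / t\<close>
  alone, decreasing in that ratio.\<close>

lemma collapse_factor_mono:
  assumes r: "0 < r" "r < 1" "0 < s" "s < t'" "t' \<le> t"
  shows "collapse_factor r s t' \<le> collapse_factor r s t"
proof -
  have eq: "collapse_factor r s t = min 1 ((1 - s / t) / (1 - r))" if "s < t" for t
  proof -
    have "collapse_factor r s t = min t ((t - s) / (1 - r)) / t"
      using that by (simp add: collapse_factor_def)
    also have "\<dots> = min (t / t) ((t - s) / (1 - r) / t)"
      using that r by (simp add: min_divide_distrib_right)
    also have "(t - s) / (1 - r) / t = (1 - s / t) / (1 - r)"
      using that r by (simp add: field_simps)
    finally show ?thesis using that r by simp
  qed
  have "s / t \<le> s / t'" using r by (simp add: frac_le)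
  then have "(1 - s / t') / (1 - r) \<le> (1 - s / t) / (1 - r)"
    using r by (simp add: divide_right_mono)
  then show ?thesis using r eq[of t] eq[of t'] by auto
qed

text \<open>The triangle inequality leaves the radial change \<open>t * a - t' * a'\<close> plus
  \<open>a\<close> times the excess \<open>dist x x' - (t - t')\<close>. After multiplication by
  \<open>1 - r\<close> the former is at most \<open>t - t'\<close>, and the nonnegative excess has
  weight at most 1.\<close>

lemma collapse_nonexpansive:
  fixes x x' y :: "'a::real_normed_vector"
  assumes r: "0 < r" "r < 1" "0 < s" and t: "s < dist x' y" "dist x' y \<le> dist x y"
  shows "(1 - r) * norm (collapse_factor r s (dist x y) *\<^sub>R (x - y)
           - collapse_factor r s (dist x' y) *\<^sub>R (x' - y)) \<le> dist x x'"
proof -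
  define t where "t = dist x y"
  define t' where "t' = dist x' y"
  define a where "a = collapse_factor r s t"
  define a' where "a' = collapse_factor r s t'"
  have tt: "s < t'" "t' \<le> t" using t by (auto simp: t_def t'_def)
  have a: "0 \<le> a" "a \<le> 1" "a' \<le> a"
    using collapse_factor_bounds[OF r] collapse_factor_mono[OF r tt] by (auto simp: a_def a'_def)
  have "t * a - t' * a' \<le> (t - t') / (1 - r)"
  proof -
    have "(t - s) / (1 - r) = (t' - s) / (1 - r) + (t - t') / (1 - r)"
      by (simp add: add_divide_distrib[symmetric])
    moreover have "t - t' \<le> (t - t') / (1 - r)"
      using r tt by (simp add: le_divide_eq mult_left_le)
    ultimately show ?thesis
      using mult_collapse_factor[of s t r] mult_collapse_factor[of s t' r] r tt
      unfolding a_def a'_def by linarith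
  qed
  then have *: "(1 - r) * (t * a - t' * a') \<le> t - t'"
    using r by (simp add: le_divide_eq mult.commute)
  have tri: "t - t' \<le> dist x x'"
    using dist_triangle[of x y x'] by (simp add: t_def t'_def)
  have "norm (a *\<^sub>R (x - y) - a' *\<^sub>R (x' - y)) = norm (a *\<^sub>R (x - x') + (a - a') *\<^sub>R (x' - y))"
    by (simp add: algebra_simps)
  also have "\<dots> \<le> a * dist x x' + (a - a') * t'"
    using norm_triangle_ineq[of "a *\<^sub>R (x - x')" "(a - a') *\<^sub>R (x' - y)"] a
    by (simp add: dist_norm t'_def)
  finally have "(1 - r) * norm (a *\<^sub>R (x - y) - a' *\<^sub>R (x' - y)) \<le> (1 - r) * (a * dist x x' + (a - a') * t')"
    using r by (intro mult_left_mono) auto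
  also have "\<dots> = (1 - r) * (t * a - t' * a') + (1 - r) * a * (dist x x' - (t - t'))"
    by (simp add: algebra_simps)
  also have "\<dots> \<le> (t - t') + (dist x x' - (t - t'))"
  proof -
    have "(1 - r) * a \<le> 1" using r a by (simp add: mult_le_one)
    then have "(1 - r) * a * (dist x x' - (t - t')) \<le> dist x x' - (t - t')"
      using tri r a by (intro mult_left_le_one_le) auto
    then show ?thesis using * by linarith
  qed
  finally show ?thesis unfolding a_def a'_def t_def t'_def by simp
qed

text \<open>The cone in direction \<open>v\<close> lives on the ball of radius \<open>s\<close>,
  where the composition of \<open>f\<close> with the collapse is constant, so their slopes never add
  up.\<close>

definition add_spike :: "real \<Rightarrow> real \<Rightarrow> ('a::real_normed_vector \<Rightarrow> 'a) \<Rightarrow> 'a \<Rightarrow> 'a \<Rightarrow> 'a \<Rightarrow> 'a" where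
  "add_spike r s f v y x =
     f (y + collapse_factor r s (dist x y) *\<^sub>R (x - y)) + max 0 (s - dist x y) *\<^sub>R v"

lemma add_spike_near:
  "dist x y \<le> s \<Longrightarrow> add_spike r s f v y x = f y + (s - dist x y) *\<^sub>R v"
  by (simp add: add_spike_def collapse_factor_def)

lemma add_spike_far:
  assumes "0 < r" "r < 1" "0 < s" "s / r \<le> dist x y"
  shows "add_spike r s f v y x = f x"
proof -
  have "s < s / r" using assms by (simp add: less_divide_eq)
  then have "s < dist x y" using assms by linarith
  \<comment> \<open>Equivalent to \<open>s \<le> r * dist x y\<close>; the minimum in the factor is
    then the distance itself, and the factor is 1.\<close>
  moreover have "dist x y \<le> (dist x y - s) / (1 - r)"
    using assms by (simp add: field_simps)
  ultimately show ?thesis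
    using assms by (auto simp: add_spike_def collapse_factor_def min_def)
qed

lemma collapse_in_convex:
  assumes "convex C" "x \<in> C" "y \<in> C" "0 < r" "r < 1" "0 < s"
  shows "y + collapse_factor r s t *\<^sub>R (x - y) \<in> C"
  using convexD_alt[OF assms(1,3,2), of "collapse_factor r s t"] collapse_factor_bounds[OF assms(4-6)]
  by (simp add: algebra_simps)

context
  fixes C :: "'a::real_normed_vector set" and f :: "'a \<Rightarrow> 'a" and r s :: real and y v :: 'a
  assumes C: "convex C" and r: "0 < r" "r < 1" "0 < s" and y: "y \<in> C"
    and f: "f ` C \<subseteq> C" and lip: "\<And>x x'. x \<in> C \<Longrightarrow> x' \<in> C \<Longrightarrow> dist (f x) (f x') \<le> (1 - r) * dist x x'"
    and v: "norm v = 1" "\<And>t. 0 \<le> t \<Longrightarrow> t \<le> s \<Longrightarrow> f y + t *\<^sub>R v \<in> C"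
begin

lemma add_spike_in:
  assumes "x \<in> C"
  shows "add_spike r s f v y x \<in> C"
proof (cases "dist x y \<le> s")
  case True
  then show ?thesis using v by (simp add: add_spike_near)
next
  case False
  then show ?thesis
    using f collapse_in_convex[OF C assms y r] by (auto simp: add_spike_def)
qed

text \<open>Inside the ball of radius \<open>s\<close> only the cone varies, with slope 1; outside,
  the factor \<open>1 - r\<close> of \<open>f\<close> cancels the Lipschitz constant of the
  collapse. For points on different sides the bounds \<open>dist x y - s\<close> and
  \<open>s - dist x' y\<close> add up to \<open>dist x y - dist x' y\<close>.\<close>

lemma add_spike_nonexpansive:
  assumes "x \<in> C" "x' \<in> C"
  shows "dist (add_spike r s f v y x) (add_spike r s f v y x') \<le> dist x x'"
proof -
  let ?g = "add_spike r s f v y"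
  have *: "dist (?g x) (?g x') \<le> dist x x'"
    if x: "x \<in> C" "x' \<in> C" and le: "dist x' y \<le> dist x y" for x x'
  proof -
    have tri: "dist x y - dist x' y \<le> dist x x'" using dist_triangle[of x y x'] by simp
    consider "dist x y \<le> s" | "dist x' y \<le> s" "s < dist x y" | "s < dist x' y" by linarith
    then show ?thesis
    proof cases
      case 1
      have "dist (?g x) (?g x') = norm ((dist x' y - dist x y) *\<^sub>R v)"
        using 1 le by (simp add: add_spike_near dist_norm algebra_simps)
      also have "\<dots> \<le> dist x x'" using le tri v by simp
      finally show ?thesis .
    next
      case 2
      let ?t = "y + collapse_factor r s (dist x y) *\<^sub>R (x - y)"
      have "dist ?t y = dist x y * collapse_factor r s (dist x y)"
        using collapse_factor_bounds[OF r] by (simp add: dist_norm)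
      also have "\<dots> \<le> (dist x y - s) / (1 - r)"
        using mult_collapse_factor[OF r(3) 2(2)] by simp
      finally have "(1 - r) * dist ?t y \<le> dist x y - s"
        using r by (simp add: le_divide_eq mult.commute)
      then have ft: "dist (f ?t) (f y) \<le> dist x y - s"
        using lip[OF collapse_in_convex[OF C x(1) y r] y] by (metis order_trans)
      have "dist (?g x) (?g x') = norm ((f ?t - f y) - (s - dist x' y) *\<^sub>R v)"
        using 2 by (simp add: add_spike_near) (simp add: add_spike_def dist_norm algebra_simps)
      also have "\<dots> \<le> dist (f ?t) (f y) + (s - dist x' y)"
        using norm_triangle_ineq4[of "f ?t - f y" "(s - dist x' y) *\<^sub>R v"] v 2
        by (simp add: dist_norm)
      also have "\<dots> \<le> dist x x'" using ft tri by simp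
      finally show ?thesis .
    next
      case 3
      let ?t = "\<lambda>x. y + collapse_factor r s (dist x y) *\<^sub>R (x - y)"
      have "dist (?g x) (?g x') = dist (f (?t x)) (f (?t x'))"
        using 3 le by (simp add: add_spike_def)
      also have "\<dots> \<le> (1 - r) * dist (?t x) (?t x')"
        using x collapse_in_convex[OF C _ y r] by (intro lip) auto
      also have "\<dots> \<le> dist x x'"
        using collapse_nonexpansive[OF r 3 le] by (simp add: dist_norm)
      finally show ?thesis .
    qed
  qed
  show ?thesis
    using *[of x x'] *[of x' x] assms by (cases "dist x' y \<le> dist x y") (auto simp: dist_commute)
qed

text \<open>The collapse moves points by at most \<open>s\<close>, so \<open>f\<close> changes by at
  most \<open>s\<close>, and the cone adds at most its height \<open>s\<close>.\<close>

lemma dist_add_spike: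
  assumes "x \<in> C"
  shows "dist (add_spike r s f v y x) (f x) \<le> 2 * s"
proof -
  let ?a = "collapse_factor r s (dist x y)"
  let ?t = "y + ?a *\<^sub>R (x - y)"
  have "dist ?t x = norm ((1 - ?a) *\<^sub>R (x - y))"
    by (simp add: dist_norm norm_minus_commute algebra_simps)
  also have "\<dots> = (1 - ?a) * dist x y"
    using collapse_factor_bounds[OF r] by (simp add: dist_norm)
  also have "\<dots> = dist x y - dist x y * ?a"
    by (simp add: algebra_simps)
  also have "\<dots> \<le> s"
  proof (cases "dist x y \<le> s")
    case False
    have "dist x y - s \<le> (dist x y - s) / (1 - r)"
      using r False by (simp add: le_divide_eq mult_left_le)
    then show ?thesis using mult_collapse_factor[of s "dist x y" r] r False by linarith
  qed (simp add: collapse_factor_def)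
  finally have "dist ?t x \<le> s" .
  moreover have "dist (f ?t) (f x) \<le> (1 - r) * dist ?t x"
    by (intro lip assms collapse_in_convex C y r)
  moreover have "(1 - r) * dist ?t x \<le> dist ?t x"
    using r by (simp add: mult_left_le_one_le)
  moreover have "dist (add_spike r s f v y x) (f ?t) \<le> s"
    using v r by (simp add: add_spike_def dist_norm)
  ultimately show ?thesis
    using dist_triangle[of "add_spike r s f v y x" "f x" "f ?t"] by linarith
qed

end

section \<open>The metric space of non-expansive maps\<close>

lemma nonexpansive_maps_iff:
  "f \<in> nonexpansive_maps C \<longleftrightarrow>
     f \<in> C \<rightarrow>\<^sub>E C \<and> (\<forall>x\<in>C. \<forall>y\<in>C. dist (f x) (f y) \<le> dist x y)"
  by (simp add: nonexpansive_maps_def dist_norm norm_minus_commute)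

lemma nonexpansive_mapsD:
  assumes "f \<in> nonexpansive_maps C"
  shows "\<And>x. x \<in> C \<Longrightarrow> f x \<in> C"
    and "\<And>x y. x \<in> C \<Longrightarrow> y \<in> C \<Longrightarrow> dist (f x) (f y) \<le> dist x y"
  using assms by (auto simp: nonexpansive_maps_iff)

lemma restrict_nonexpansive_maps:
  assumes "\<And>x. x \<in> C \<Longrightarrow> f x \<in> C" "\<And>x y. x \<in> C \<Longrightarrow> y \<in> C \<Longrightarrow> dist (f x) (f y) \<le> dist x y"
  shows "restrict f C \<in> nonexpansive_maps C"
  using assms by (auto simp: nonexpansive_maps_iff)

lemma dist_le_sup_dist:
  assumes C: "bounded C" and "f \<in> nonexpansive_maps C" "g \<in> nonexpansive_maps C" "x \<in> C"
  shows "dist (f x) (g x) \<le> sup_dist C f g"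
proof -
  obtain b where "\<And>x y. x \<in> C \<Longrightarrow> y \<in> C \<Longrightarrow> dist x y \<le> b"
    using C by (meson bounded_two_points)
  then have "bdd_above ((\<lambda>x. norm (g x - f x)) ` C)"
    using nonexpansive_mapsD(1)[OF assms(2)] nonexpansive_mapsD(1)[OF assms(3)]
    by (intro bdd_aboveI2[where M = b]) (simp flip: dist_norm)
  then show ?thesis
    using assms cSUP_upper[OF assms(4)]
    by (simp add: sup_dist_def dist_norm norm_minus_commute)
qed

lemma sup_dist_le:
  assumes "C \<noteq> {}" "f \<in> nonexpansive_maps C" "g \<in> nonexpansive_maps C"
    and "\<And>x. x \<in> C \<Longrightarrow> dist (f x) (g x) \<le> B"
  shows "sup_dist C f g \<le> B"
  using assms cSUP_least[of C "\<lambda>x. norm (g x - f x)" B]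
  by (simp add: sup_dist_def dist_norm norm_minus_commute)

lemma nonexpansive_maps_interpolate:
  fixes C :: "'a::real_normed_vector set"
  assumes "convex C" "f \<in> nonexpansive_maps C" "q \<in> C" "0 \<le> t" "t \<le> 1"
  shows "\<And>x. x \<in> C \<Longrightarrow> (1 - t) *\<^sub>R f x + t *\<^sub>R q \<in> C"
    and "\<And>x y. x \<in> C \<Longrightarrow> y \<in> C \<Longrightarrow>
           dist ((1 - t) *\<^sub>R f x + t *\<^sub>R q) ((1 - t) *\<^sub>R f y + t *\<^sub>R q) \<le> (1 - t) * dist x y"
    and "\<And>x. dist (f x) ((1 - t) *\<^sub>R f x + t *\<^sub>R q) = t * dist (f x) q"
proof -
  note f = nonexpansive_mapsD[OF assms(2)]
  show "(1 - t) *\<^sub>R f x + t *\<^sub>R q \<in> C" if "x \<in> C" for x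
    using convexD_alt[OF assms(1) f(1)[OF that] assms(3-5)] .
  show "dist ((1 - t) *\<^sub>R f x + t *\<^sub>R q) ((1 - t) *\<^sub>R f y + t *\<^sub>R q) \<le> (1 - t) * dist x y"
    if "x \<in> C" "y \<in> C" for x y
    using f(2)[OF that] assms(5)
    by (simp add: dist_norm mult_left_mono flip: scaleR_diff_right)
  show "dist (f x) ((1 - t) *\<^sub>R f x + t *\<^sub>R q) = t * dist (f x) q" for x
  proof -
    have "dist (f x) ((1 - t) *\<^sub>R f x + t *\<^sub>R q) = norm (t *\<^sub>R (f x - q))"
      by (simp add: dist_norm algebra_simps)
    then show ?thesis using assms(4) by (simp add: dist_norm)
  qed
qed

text \<open>On the segment from \<open>f\<close> to the constant map \<open>q\<close> the distance
  to \<open>f\<close> is \<open>t * L\<close>, so \<open>t = r / L\<close> attains \<open>r\<close>;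
  \<open>L\<close> is large enough because \<open>q\<close> is far from \<open>f a\<close>.\<close>

lemma nonexpansive_maps_sphere_point:
  fixes C :: "'a::real_normed_vector set"
  assumes C: "convex C" "bounded C" "a \<in> C" "b \<in> C" and f: "f \<in> nonexpansive_maps C"
    and r: "0 < r" "r \<le> dist a b / 2"
  shows "\<exists>h\<in>nonexpansive_maps C. sup_dist C f h = r"
proof -
  obtain q where q: "q \<in> C" "dist a b / 2 \<le> dist (f a) q"
    using far_point[of a b "f a"] C by blast
  define L where "L = sup_dist C f (restrict (\<lambda>x. q) C)"
  have qM: "restrict (\<lambda>x. q) C \<in> nonexpansive_maps C"
    using q by (intro restrict_nonexpansive_maps) auto
  have L: "dist (f x) q \<le> L" if "x \<in> C" for x
    using dist_le_sup_dist[OF C(2) f qM that] that by (simp add: L_def)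
  have rL: "0 < L" "r \<le> L" using L[OF C(3)] q r by linarith+
  define t where "t = r / L"
  have t: "0 < t" "t \<le> 1" "t * L = r" using rL r by (auto simp: t_def)
  define h where "h = restrict (\<lambda>x. (1 - t) *\<^sub>R f x + t *\<^sub>R q) C"
  note ip = nonexpansive_maps_interpolate[OF C(1) f q(1) order_less_imp_le[OF t(1)] t(2)]
  have hM: "h \<in> nonexpansive_maps C"
    unfolding h_def
  proof (rule restrict_nonexpansive_maps[OF ip(1)])
    fix x y assume xy: "x \<in> C" "y \<in> C"
    have "(1 - t) * dist x y \<le> dist x y"
      using t by (intro mult_left_le_one_le) auto
    then show "dist ((1 - t) *\<^sub>R f x + t *\<^sub>R q) ((1 - t) *\<^sub>R f y + t *\<^sub>R q) \<le> dist x y"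
      using ip(2)[OF xy] by linarith
  qed
  have dh: "dist (f x) (h x) = t * dist (f x) q" if "x \<in> C" for x
    using ip(3) that by (simp add: h_def)
  have ne: "C \<noteq> {}" using C by blast
  have "sup_dist C f h \<le> r"
  proof (rule sup_dist_le[OF ne f hM])
    fix x assume x: "x \<in> C"
    have "t * dist (f x) q \<le> t * L" using L[OF x] t by (intro mult_left_mono) auto
    then show "dist (f x) (h x) \<le> r" using dh[OF x] t by simp
  qed
  moreover have "L \<le> sup_dist C f h / t"
    unfolding L_def
  proof (rule sup_dist_le[OF ne f qM])
    fix x assume "x \<in> C"
    then show "dist (f x) (restrict (\<lambda>x. q) C x) \<le> sup_dist C f h / t"
      using dist_le_sup_dist[OF C(2) f hM, of x] dh[of x] t by (simp add: le_divide_eq mult.commute)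
  qed
  then have "r \<le> sup_dist C f h"
    using t by (simp add: le_divide_eq mult.commute)
  ultimately show ?thesis using hM by (intro bexI[of _ h]) auto
qed

section \<open>Gluing many spikes and the holes they force\<close>

lemma dist_closed_segment_split:
  fixes x x' :: "'a::real_normed_vector"
  assumes "p \<in> closed_segment x x'"
  shows "dist x x' = dist x p + dist p x'"
proof -
  obtain u where u: "0 \<le> u" "u \<le> 1" "p = (1 - u) *\<^sub>R x + u *\<^sub>R x'"
    using assms by (auto simp: in_segment)
  have "x - p = u *\<^sub>R (x - x')" "p - x' = (1 - u) *\<^sub>R (x - x')"
    using u by (auto simp: algebra_simps)
  then have "dist x p + dist p x' = u * dist x x' + (1 - u) * dist x x'"
    using u by (simp add: dist_norm)
  then show ?thesis by (simp add: algebra_simps)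
qed

text \<open>Each spike changes \<open>f\<close> only inside a ball of radius \<open>\<rho>\<close>,
  and separation makes these open balls disjoint. The pieces agree with \<open>f\<close> on the
  bounding spheres, so a segment that leaves a ball can be cut there and the estimates
  added.\<close>

lemma many_spikes:
  fixes C :: "'a::real_normed_vector set"
  assumes C: "convex C" and r: "0 < r" "r < 1" and \<rho>: "0 < \<rho>"
    and S: "S \<subseteq> C" and sep: "\<And>y y'. y \<in> S \<Longrightarrow> y' \<in> S \<Longrightarrow> y \<noteq> y' \<Longrightarrow> 2 * \<rho> \<le> dist y y'"
    and f: "f ` C \<subseteq> C" and lip: "\<And>x x'. x \<in> C \<Longrightarrow> x' \<in> C \<Longrightarrow> dist (f x) (f x') \<le> (1 - r) * dist x x'"
    and v: "\<And>y. y \<in> S \<Longrightarrow> norm (v y) = 1"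
      "\<And>y t. y \<in> S \<Longrightarrow> 0 \<le> t \<Longrightarrow> t \<le> r * \<rho> \<Longrightarrow> f y + t *\<^sub>R v y \<in> C"
  obtains g where "g \<in> nonexpansive_maps C"
    "\<And>x. x \<in> C \<Longrightarrow> dist (g x) (f x) \<le> 2 * (r * \<rho>)"
    "\<And>x y. x \<in> C \<Longrightarrow> y \<in> S \<Longrightarrow> dist x y \<le> r * \<rho> \<Longrightarrow> g x = f y + (r * \<rho> - dist x y) *\<^sub>R v y"
proof -
  define s where "s = r * \<rho>"
  have s: "0 < s" "s / r = \<rho>" "s \<le> \<rho>"
    using r \<rho> by (auto simp: s_def mult_left_le_one_le)
  define G where "G y = add_spike r s f (v y) y" for y
  define g where "g x = (if \<exists>y\<in>S. dist x y < \<rho> then G (SOME y. y \<in> S \<and> dist x y < \<rho>) x else f x)" for x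
  have G_in: "G y x \<in> C" if "y \<in> S" "x \<in> C" for x y
    unfolding G_def using that S v by (intro add_spike_in[OF C r s(1) _ f lip]) (auto simp: s_def)
  have G_lip: "dist (G y x) (G y x') \<le> dist x x'" if "y \<in> S" "x \<in> C" "x' \<in> C" for x x' y
    unfolding G_def using that S v
    by (intro add_spike_nonexpansive[OF C r s(1) _ f lip]) (auto simp: s_def)
  have G_dist: "dist (G y x) (f x) \<le> 2 * s" if "y \<in> S" "x \<in> C" for x y
    unfolding G_def using that S v by (intro dist_add_spike[OF C r s(1) _ f lip]) (auto simp: s_def)
  have G_far: "G y x = f x" if "\<rho> \<le> dist x y" for x y
    unfolding G_def using add_spike_far[OF r s(1)] s(2) that by simp
  \<comment> \<open>A point of the closed ball around one centre is outside the open balls around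
    the others; hence the choice in \<open>g\<close> is unambiguous.\<close>
  have sep': "\<rho> \<le> dist x y'" if "y \<in> S" "y' \<in> S" "y \<noteq> y'" "dist x y \<le> \<rho>" for x y y'
    using sep[OF that(1-3)] dist_triangle[of y y' x] that(4) by (simp add: dist_commute)
  have g_near: "g x = G y x" if y: "y \<in> S" "dist x y \<le> \<rho>" for x y
  proof (cases "\<exists>y\<in>S. dist x y < \<rho>")
    case True
    define y' where "y' = (SOME y. y \<in> S \<and> dist x y < \<rho>)"
    have "\<exists>y. y \<in> S \<and> dist x y < \<rho>" using True by blast
    then have "y' \<in> S \<and> dist x y' < \<rho>"
      unfolding y'_def by (rule someI_ex)
    then have "y' = y" using sep'[of y y' x] y by (metis not_less)
    then show ?thesis using True by (simp add: g_def y'_def)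
  next
    case False
    then have "\<rho> \<le> dist x y" using y by auto
    then show ?thesis using False G_far by (simp add: g_def)
  qed
  have g_cases: "(\<exists>y\<in>S. dist x y < \<rho> \<and> g x = G y x) \<or> g x = f x" for x
  proof (cases "\<exists>y\<in>S. dist x y < \<rho>")
    case True
    then show ?thesis using g_near[of _ x] by (meson less_imp_le)
  next
    case False
    then have "g x = f x" by (simp add: g_def)
    then show ?thesis ..
  qed
  have f_lip: "dist (f x) (f x') \<le> dist x x'" if "x \<in> C" "x' \<in> C" for x x'
    using lip[OF that] r mult_left_le_one_le[of "dist x x'" "1 - r"] by simp
  have g_lip1: "dist (g x) (g x') \<le> dist x x'"
    if x: "x \<in> C" "x' \<in> C" and y: "y \<in> S" "dist x y < \<rho>" for x x' y
  proof (cases "dist x' y \<le> \<rho>")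
    case True
    then show ?thesis using g_near[OF y(1)] y G_lip x by simp
  next
    case False
    then obtain p where p: "p \<in> closed_segment x x'" "dist p y = \<rho>"
      using closed_segment_sphere[of x y \<rho> x'] y by auto
    have pC: "p \<in> C" using p(1) closed_segment_subset[OF x C] by blast
    have "dist (g x) (f p) \<le> dist x p"
      using g_near[of y x] G_far[of p y] G_lip[of y x p] y x pC p(2) by simp
    moreover have "dist (f p) (g x') \<le> dist p x'"
      using g_cases[of x']
    proof (elim disjE bexE conjE)
      fix y' assume y': "y' \<in> S" "dist x' y' < \<rho>" "g x' = G y' x'"
      \<comment> \<open>\<open>x'\<close> is outside the ball of \<open>y\<close>, so
        \<open>y'\<close> is another centre, and \<open>p\<close>, on the sphere around
        \<open>y\<close>, is outside the open ball of \<open>y'\<close>; hence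
        \<open>G y' p = f p\<close>.\<close>
      then have "\<rho> \<le> dist p y'" using sep'[of y y' p] y p False by force
      then show ?thesis using G_lip[of y' p x'] G_far[of p y'] y' pC x by simp
    qed (use f_lip pC x in simp)
    moreover have "dist x x' = dist x p + dist p x'"
      by (rule dist_closed_segment_split[OF p(1)])
    ultimately show ?thesis
      using dist_triangle[of "g x" "g x'" "f p"] by linarith
  qed
  have g_lip: "dist (g x) (g x') \<le> dist x x'" if "x \<in> C" "x' \<in> C" for x x'
    using g_cases[of x] g_cases[of x'] g_lip1[of x x'] g_lip1[of x' x] f_lip[of x x'] that
    by (metis dist_commute)
  have "g x \<in> C" if "x \<in> C" for x
    using g_cases[of x] G_in f that by auto
  then have "restrict g C \<in> nonexpansive_maps C"
    using g_lip by (intro restrict_nonexpansive_maps) auto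
  moreover have "dist (g x) (f x) \<le> 2 * (r * \<rho>)" if "x \<in> C" for x
    using g_cases[of x] G_dist that s(1) by (auto simp: s_def)
  moreover have "g x = f y + (r * \<rho> - dist x y) *\<^sub>R v y" if "y \<in> S" "dist x y \<le> r * \<rho>" for x y
    using g_near[of y x] that s(3) add_spike_near[of x y s r f "v y"] by (simp add: G_def s_def)
  ultimately show ?thesis
    by (intro that[of "restrict g C"]) auto
qed

definition flat_set :: "'a::metric_space set \<Rightarrow> ('a \<Rightarrow> 'a) \<Rightarrow> real \<Rightarrow> 'a set" where
  "flat_set C f \<epsilon> = {x \<in> C. \<forall>y\<in>C. dist x y \<le> \<epsilon> \<longrightarrow> dist (f x) (f y) \<le> (1 - \<epsilon>) * dist x y}"

text \<open>With \<open>s = r * \<rho>\<close>, \<open>g\<close> varies by more than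
  \<open>s / 2 - \<sigma>\<close> between a point \<open>z\<close> within \<open>\<sigma>\<close> of
  a centre and a point \<open>w\<close> halfway down its spike. Passing to \<open>h\<close> costs
  \<open>2 * \<sigma>\<close>, and \<open>dist z w\<close> may exceed \<open>s / 2\<close> by
  \<open>\<sigma>\<close>. Flatness at \<open>z\<close> would need a loss of
  \<open>\<epsilon> * s / 2 = 5 * \<sigma>\<close>, more than these four.\<close>

lemma perturbation_with_holes:
  fixes C :: "'a::real_normed_vector set"
  assumes C: "convex C" "a \<in> C" "b \<in> C" and f: "f \<in> nonexpansive_maps C"
    and D: "\<And>x y. x \<in> C \<Longrightarrow> y \<in> C \<Longrightarrow> dist x y \<le> D"
    and r: "0 < r" "r < 1" and \<rho>: "0 < \<rho>" "\<rho> \<le> \<epsilon>" "\<rho> \<le> dist a b / 2" and \<epsilon>: "\<epsilon> \<le> 1"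
    and \<sigma>: "\<sigma> = \<epsilon> * (r * \<rho>) / 10"
  obtains g where "g \<in> nonexpansive_maps C" "\<And>x. x \<in> C \<Longrightarrow> dist (f x) (g x) \<le> r * (D + 2 * \<rho>)"
    "\<And>h x. (\<And>x. x \<in> C \<Longrightarrow> dist (g x) (h x) < \<sigma>) \<Longrightarrow> x \<in> C \<Longrightarrow>
       \<exists>y\<in>C. dist x y < 2 * \<rho> \<and> (\<forall>z\<in>C. dist y z < \<sigma> \<longrightarrow> z \<notin> flat_set C h \<epsilon>)"
proof -
  \<comment> \<open>Pulling \<open>f\<close> towards \<open>a\<close> lowers its Lipschitz constant
    to \<open>1 - r\<close> at a cost of at most \<open>r * D\<close>.\<close>
  define f1 where "f1 x = (1 - r) *\<^sub>R f x + r *\<^sub>R a" for x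
  note ip = nonexpansive_maps_interpolate[OF C(1) f C(2) less_imp_le[OF r(1)] less_imp_le[OF r(2)], folded f1_def]
  obtain S where S: "S \<subseteq> C" "\<And>y y'. y \<in> S \<Longrightarrow> y' \<in> S \<Longrightarrow> y \<noteq> y' \<Longrightarrow> 2 * \<rho> \<le> dist y y'"
    "\<And>x. x \<in> C \<Longrightarrow> \<exists>y\<in>S. dist x y < 2 * \<rho>"
    using maximal_separated_subset[of "2 * \<rho>" C] \<rho> by auto
  have far: "\<exists>q\<in>C. \<rho> \<le> dist x q" for x
    using far_point[of a b x] C \<rho> by force
  define s where "s = r * \<rho>"
  have s: "0 < s" "s \<le> \<rho>" using r \<rho> by (auto simp: s_def mult_left_le_one_le)
  have "\<exists>v. norm v = 1 \<and> (\<forall>t. 0 \<le> t \<longrightarrow> t \<le> s \<longrightarrow> f1 y + t *\<^sub>R v \<in> C)" if "y \<in> S" for y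
  proof -
    obtain q where q: "q \<in> C" "\<rho> \<le> dist (f1 y) q" using far by blast
    \<comment> \<open>The spike points towards a point of \<open>C\<close> at distance at least
      \<open>\<rho> \<ge> s\<close>, so by convexity it stays in \<open>C\<close>.\<close>
    define v where "v = (q - f1 y) /\<^sub>R dist (f1 y) q"
    have "f1 y + t *\<^sub>R v \<in> C" if t: "0 \<le> t" "t \<le> s" for t
    proof -
      define u where "u = t / dist (f1 y) q"
      have "f1 y + t *\<^sub>R v = (1 - u) *\<^sub>R f1 y + u *\<^sub>R q"
        by (simp add: v_def u_def divide_inverse algebra_simps)
      moreover have "0 \<le> u" "u \<le> 1"
        using t s q \<rho> by (auto simp: u_def divide_le_eq)
      ultimately show ?thesis
        using convexD_alt[OF C(1) ip(1) q(1)] \<open>y \<in> S\<close> S(1) by auto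
    qed
    moreover have "norm v = 1"
    proof -
      have "f1 y \<noteq> q" using q(2) \<rho>(1) by auto
      then show ?thesis by (simp add: v_def dist_norm norm_minus_commute)
    qed
    ultimately show ?thesis by blast
  qed
  then obtain v where v: "\<And>y. y \<in> S \<Longrightarrow> norm (v y) = 1"
      "\<And>y t. y \<in> S \<Longrightarrow> 0 \<le> t \<Longrightarrow> t \<le> s \<Longrightarrow> f1 y + t *\<^sub>R v y \<in> C"
    by metis
  obtain g where g: "g \<in> nonexpansive_maps C"
    "\<And>x. x \<in> C \<Longrightarrow> dist (g x) (f1 x) \<le> 2 * s"
    "\<And>x y. x \<in> C \<Longrightarrow> y \<in> S \<Longrightarrow> dist x y \<le> s \<Longrightarrow> g x = f1 y + (s - dist x y) *\<^sub>R v y"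
    unfolding s_def
  proof (rule many_spikes[OF C(1) r \<rho>(1) S(1,2), of f1 v])
    show "f1 ` C \<subseteq> C" using ip(1) by blast
  qed (use ip(2) v in \<open>simp_all add: s_def\<close>)
  have close: "dist (f x) (g x) \<le> r * (D + 2 * \<rho>)" if "x \<in> C" for x
  proof -
    have "dist (f x) (f1 x) \<le> r * D"
      using ip(3)[of x] D[OF nonexpansive_mapsD(1)[OF f that] C(2)] r by simp
    then show ?thesis
      using g(2)[OF that] dist_triangle[of "f x" "g x" "f1 x"]
      by (simp add: s_def dist_commute algebra_simps)
  qed
  have "\<epsilon> * s \<le> s" using s \<epsilon> \<rho> by (intro mult_left_le_one_le) auto
  then have \<sigma>s: "10 * \<sigma> = \<epsilon> * s" "\<sigma> > 0" "10 * \<sigma> \<le> s"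
    using \<rho> s \<epsilon> by (auto simp: \<sigma> s_def)
  have hole: "\<exists>y\<in>C. dist x y < 2 * \<rho> \<and> (\<forall>z\<in>C. dist y z < \<sigma> \<longrightarrow> z \<notin> flat_set C h \<epsilon>)"
    if h: "\<And>x. x \<in> C \<Longrightarrow> dist (g x) (h x) < \<sigma>" and x: "x \<in> C" for h x
  proof -
    obtain y where y: "y \<in> S" "dist x y < 2 * \<rho>" using S(3)[OF x] by blast
    then have yC: "y \<in> C" using S(1) by blast
    have False if z: "z \<in> C" "dist y z < \<sigma>" "z \<in> flat_set C h \<epsilon>" for z
    proof -
      obtain q where "q \<in> C" "\<rho> \<le> dist y q" using far by blast
      then obtain w where w: "w \<in> C" "dist y w = s / 2"
        using convex_sphere_point[OF C(1) yC, of q "s / 2"] s by auto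
      have "g z = f1 y + (s - dist z y) *\<^sub>R v y" "g w = f1 y + (s / 2) *\<^sub>R v y"
        using g(3)[OF z(1) y(1)] g(3)[OF w(1) y(1)] z w(2) s \<sigma>s by (auto simp: dist_commute)
      then have "g w - g z = (dist z y - s / 2) *\<^sub>R v y"
        by (simp flip: scaleR_left_diff_distrib)
      then have "dist (g z) (g w) = \<bar>dist z y - s / 2\<bar>"
        using v(1)[OF y(1)] by (simp add: dist_norm norm_minus_commute)
      then have "s / 2 - \<sigma> < dist (g z) (g w)"
        using z(2) by (simp add: dist_commute)
      moreover have "dist (g z) (g w) \<le> dist (g z) (h z) + dist (h z) (h w) + dist (g w) (h w)"
        using dist_triangle[of "g z" "g w" "h z"] dist_triangle[of "h z" "g w" "h w"]
        by (simp add: dist_commute)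
      ultimately have 1: "s / 2 - 3 * \<sigma> < dist (h z) (h w)"
        using h[OF z(1)] h[OF w(1)] by linarith
      have zw: "dist z w < s / 2 + \<sigma>"
        using dist_triangle[of z w y] w z by (simp add: dist_commute)
      then have "dist z w \<le> \<epsilon>" using \<sigma>s s \<rho> by linarith
      then have "dist (h z) (h w) \<le> (1 - \<epsilon>) * dist z w"
        using z(3) w(1) by (simp add: flat_set_def)
      also have "\<dots> \<le> (1 - \<epsilon>) * (s / 2 + \<sigma>)"
        using zw \<epsilon> by (intro mult_left_mono) auto
      also have "\<dots> = s / 2 + \<sigma> - (\<epsilon> * s) / 2 - \<epsilon> * \<sigma>"
        by (simp add: field_simps)
      also have "\<dots> \<le> s / 2 - 4 * \<sigma>"
        using \<sigma>s \<rho> by (simp flip: \<sigma>s(1))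
      finally show False using 1 \<sigma>s by linarith
    qed
    then show ?thesis using y yC by blast
  qed
  show ?thesis using that[OF g(1) close hole] .
qed

subsection \<open>Flat sets and the choice of scales\<close>

text \<open>The supremum \<open>F r\<close> is monotone in \<open>r\<close> and at most 1, so its
  limit is its infimum. Flatness with parameter \<open>\<epsilon>\<close> gives
  \<open>F \<epsilon> \<le> 1 - \<epsilon>\<close>, also at isolated points, where suprema of the
  empty set occur. If flatness fails for all parameters, \<open>F\<close> is 1 at every positive
  radius.\<close>

lemma Lip_at_eq_1_iff:
  assumes f: "f \<in> nonexpansive_maps C" and x: "x \<in> C"
  shows "Lip_at C f x = 1 \<longleftrightarrow> (\<forall>n. x \<notin> flat_set C f (1 / Suc n))"
proof -
  define F where "F r = Sup {ereal (norm (f y - f x) / norm (y - x)) | y.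
       y \<in> C \<and> 0 < norm (y - x) \<and> norm (y - x) \<le> r}" for r
  have Lip: "Lip_at C f x = Lim (at_right 0) F"
    unfolding Lip_at_def F_def ..
  have mono: "F r \<le> F r'" if "r \<le> r'" for r r'
    unfolding F_def using that by (intro Sup_subset_mono) auto
  have F_le_1: "F r \<le> 1" for r
    unfolding F_def using f x
    by (intro Sup_least) (auto simp: nonexpansive_maps_def divide_le_eq)
  show ?thesis
  proof (cases "\<exists>n. x \<in> flat_set C f (1 / Suc n)")
    case True
    then obtain n where n: "x \<in> flat_set C f (1 / Suc n)" by blast
    define \<epsilon> where "\<epsilon> = 1 / real (Suc n)"
    have \<epsilon>: "\<epsilon> > 0" by (simp add: \<epsilon>_def)
    have "F \<epsilon> \<le> ereal (1 - \<epsilon>)"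
      unfolding F_def
    proof (rule Sup_least, clarify)
      fix y assume y: "y \<in> C" "0 < norm (y - x)" "norm (y - x) \<le> \<epsilon>"
      then have "dist (f x) (f y) \<le> (1 - \<epsilon>) * dist x y"
        using n by (simp add: flat_set_def \<epsilon>_def dist_commute[of y x] flip: dist_norm)
      then show "ereal (norm (f y - f x) / norm (y - x)) \<le> ereal (1 - \<epsilon>)"
        using y by (simp add: dist_norm norm_minus_commute divide_le_eq)
    qed
    moreover have "(F \<longlongrightarrow> (INF r\<in>{0<..}. F r)) (at_right 0)"
    proof (rule order_tendstoI)
      fix a assume "a < (INF r\<in>{0<..}. F r)"
      then have "a < F r" if "r > 0" for r
        using that by (meson INF_lower greaterThan_iff less_le_trans)
      then show "\<forall>\<^sub>F r in at_right 0. a < F r"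
        by (auto simp: eventually_at_right_field intro: exI[of _ 1])
    next
      fix a assume "(INF r\<in>{0<..}. F r) < a"
      then obtain r where "r > 0" "F r < a" by (auto simp: INF_less_iff)
      then show "\<forall>\<^sub>F r in at_right 0. F r < a"
        unfolding eventually_at_right_field by (meson le_less_trans less_imp_le mono)
    qed
    then have "Lip_at C f x = (INF r\<in>{0<..}. F r)"
      unfolding Lip by (intro tendsto_Lim) auto
    moreover have "(INF r\<in>{0<..}. F r) \<le> F \<epsilon>" using \<epsilon> by (intro INF_lower) auto
    ultimately have "Lip_at C f x \<le> ereal (1 - \<epsilon>)" by simp
    moreover have "ereal (1 - \<epsilon>) < 1" using \<epsilon> by simp
    ultimately have "Lip_at C f x \<noteq> 1" by auto
    then show ?thesis using True by blast
  next
    case False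
    have "F r = 1" if "r > 0" for r
    proof (rule antisym[OF F_le_1], rule ereal_le_epsilon2)
      fix e :: real assume "e > 0"
      obtain n where n: "inverse (real (Suc n)) < min r e"
        using reals_Archimedean[of "min r e"] \<open>r > 0\<close> \<open>e > 0\<close> by auto
      define \<epsilon> where "\<epsilon> = 1 / real (Suc n)"
      have \<epsilon>: "\<epsilon> < r" "\<epsilon> < e" using n by (auto simp: \<epsilon>_def inverse_eq_divide)
      obtain y where y: "y \<in> C" "dist x y \<le> \<epsilon>" "(1 - \<epsilon>) * dist x y < dist (f x) (f y)"
        using False x unfolding flat_set_def \<epsilon>_def by force
      then have pos: "0 < norm (y - x)" by auto
      have "ereal (1 - \<epsilon>) \<le> ereal (norm (f y - f x) / norm (y - x))"
        using y pos by (simp add: le_divide_eq dist_norm norm_minus_commute)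
      also have "\<dots> \<le> F r"
        unfolding F_def using y pos \<epsilon> by (intro Sup_upper) (auto simp: dist_norm norm_minus_commute)
      finally have "ereal (1 - \<epsilon>) \<le> F r" .
      then have "ereal (1 - \<epsilon>) + ereal e \<le> F r + ereal e" by (rule add_right_mono)
      moreover have "1 \<le> ereal (1 - \<epsilon>) + ereal e" using \<epsilon> by simp
      ultimately show "1 \<le> F r + ereal e" by (rule order_trans[rotated])
    qed
    then have "\<forall>\<^sub>F r in at_right 0. F r = 1"
      by (auto simp: eventually_at_right_field intro: exI[of _ 1])
    then have "Lip_at C f x = 1"
      unfolding Lip by (intro tendsto_Lim tendsto_eventually) auto
    then show ?thesis using False by blast
  qed
qed

text \<open>The chord from 0 is replaced by one from a point \<open>a\<close> strictly between 0 and
  \<open>t\<close>, since 0 is outside the interval. Giving \<open>b\<close> only the weight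
  \<open>t / (2 * b)\<close> keeps \<open>a\<close> positive and costs the factor 2.\<close>

lemma concave_gauge_lower_bound:
  fixes \<xi> :: "real \<Rightarrow> real"
  assumes conc: "concave_on {0<..<\<eta>} \<xi>" and pos: "\<And>t. t \<in> {0<..<\<eta>} \<Longrightarrow> \<xi> t > 0"
    and b: "b \<in> {0<..<\<eta>}" and t: "0 < t" "t < b"
  shows "t \<le> 2 * b / \<xi> b * \<xi> t"
proof -
  define u where "u = t / (2 * b)"
  have u: "0 \<le> u" "u \<le> 1" using t b by (auto simp: u_def)
  define a where "a = (t - u * b) / (1 - u)"
  have "u < 1" using t by (auto simp: u_def divide_less_eq)
  then have eq: "(1 - u) *\<^sub>R a + u *\<^sub>R b = t" by (simp add: a_def)
  have ub: "u * b = t / 2" using t by (simp add: u_def)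
  have "0 < a" using \<open>u < 1\<close> t by (simp add: a_def ub)
  have "1 / 2 < 1 - u" using t by (simp add: u_def divide_less_eq)
  have "a < t"
  proof -
    have "t * (1 / 2) < t * (1 - u)" using \<open>1 / 2 < 1 - u\<close> t(1) by (rule mult_strict_left_mono)
    then have "t - t / 2 < t * (1 - u)" by linarith
    then show ?thesis using \<open>u < 1\<close> by (simp only: a_def ub pos_divide_less_eq diff_gt_0_iff_gt)
  qed
  then have aI: "a \<in> {0<..<\<eta>}" using \<open>0 < a\<close> t b by auto
  have "u * \<xi> b \<le> (1 - u) * \<xi> a + u * \<xi> b"
    using u pos[OF aI] by (simp add: less_imp_le)
  also have "\<dots> \<le> \<xi> t"
    using concave_onD[OF conc u aI b] eq by simp
  finally show ?thesis
    using t pos[OF b] by (simp add: u_def field_simps)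
qed

lemma concave_gauge_attains:
  fixes \<xi> :: "real \<Rightarrow> real"
  assumes conc: "concave_on {0<..<\<eta>} \<xi>" and b: "b \<in> {0<..<\<eta>}"
    and lim: "(\<xi> \<longlongrightarrow> 0) (at_right 0)" and v: "0 < v" "v < \<xi> b"
  shows "\<exists>t\<in>{0<..<b}. \<xi> t = v"
proof -
  have "continuous_on {0<..<\<eta>} (\<lambda>t. - \<xi> t)"
    using conc unfolding concave_on_def by (intro convex_on_continuous) auto
  then have cont: "continuous_on {0<..<\<eta>} \<xi>"
    using continuous_on_minus by fastforce
  have "\<forall>\<^sub>F t in at_right 0. \<xi> t < v \<and> t \<in> {0<..<b}"
    using order_tendstoD(2)[OF lim v(1)] eventually_at_right_real[of 0 b] b
    by (intro eventually_conj) auto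
  then obtain a where a: "\<xi> a < v" "a \<in> {0<..<b}"
    using eventually_happens[of _ "at_right (0::real)"] by force
  have "\<exists>t\<ge>a. t \<le> b \<and> \<xi> t = v"
    using a b v by (intro IVT' continuous_on_subset[OF cont]) auto
  then obtain t where "a \<le> t" "t \<le> b" "\<xi> t = v" by blast
  moreover from this have "t \<noteq> b" using v by auto
  ultimately show ?thesis using a by (intro bexI[of _ t]) auto
qed

text \<open>One pair of \<open>\<rho>\<close> and \<open>\<sigma>\<close> serves all
  \<open>x\<close>. As \<open>c\<close> is separate from \<open>\<delta>\<close>, letting
  \<open>\<delta>\<close> tend to 0 can keep one porosity constant.\<close>

definition holes_below_scale ::
  "'a::metric_space set \<Rightarrow> (real \<Rightarrow> real) \<Rightarrow> real \<Rightarrow> real \<Rightarrow> real \<Rightarrow> 'a set \<Rightarrow> bool" where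
  "holes_below_scale C \<phi> \<eta> c \<delta> P \<longleftrightarrow>
     (\<exists>\<rho>\<in>{0<..<\<delta>}. \<exists>\<sigma>\<in>{0<..<\<eta>}. \<sigma> \<le> \<rho> \<and> c * \<rho> \<le> \<phi> \<sigma> \<and>
       (\<forall>x\<in>C. \<exists>y\<in>C. dist x y < 2 * \<rho> \<and> (\<forall>z\<in>C. dist y z < \<sigma> \<longrightarrow> z \<notin> P)))"

lemma holes_below_scale_mono:
  assumes "holes_below_scale C \<phi> \<eta> c \<delta> P" "\<delta> \<le> \<delta>'"
  shows "holes_below_scale C \<phi> \<eta> c \<delta>' P"
proof -
  have "{0<..<\<delta>} \<subseteq> {0<..<\<delta>'}" using assms(2) by auto
  then show ?thesis
    using assms(1) unfolding holes_below_scale_def by (elim bexE, intro bexI) blast+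
qed

lemma upper_porous_of_holes:
  fixes C :: "'a::real_normed_vector set"
  assumes C: "convex C" "a \<in> C" "b \<in> C" "a \<noteq> b"
    and \<phi>: "strict_mono_on {0<..<\<eta>} \<phi>" and "\<eta> > 0" "c > 0" and P: "P \<subseteq> C"
    and holes: "\<And>\<delta>. \<delta> > 0 \<Longrightarrow> holes_below_scale C \<phi> \<eta> c \<delta> P"
  shows "Metric_space.upper_porous C dist \<phi> P"
proof -
  interpret Metric_space C dist by (rule Metric_space_subset)
  have "upper_porous_at \<phi> P x" if "x \<in> P" for x
  \<comment> \<open>As \<open>\<sigma> \<le> \<rho>\<close>, holes at scale \<open>\<rho>\<close>
    fit into balls of radius \<open>3 * \<rho>\<close>, hence \<open>c / 3\<close>.\<close>
  proof (rule upper_porous_atI[OF \<phi>, where c = "c / 3" and ?r0.0 = "dist a b / 2"])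
    show x: "x \<in> C" using that P by blast
    show "\<exists>z\<in>C. dist x z = r" if "r \<in> {0<..<dist a b / 2}" for r
    proof -
      obtain q where "q \<in> C" "dist a b / 2 \<le> dist x q"
        using far_point[of a b x] C by blast
      then show ?thesis using convex_sphere_point[OF C(1) x, of q r] that by auto
    qed
    fix r' :: real assume "r' > 0"
    then have "holes_below_scale C \<phi> \<eta> c (r' / 3) P" by (intro holes) simp
    then obtain \<rho> \<sigma> where *: "0 < \<rho>" "\<rho> < r' / 3" "0 < \<sigma>" "\<sigma> \<le> \<rho>" "c * \<rho> \<le> \<phi> \<sigma>"
      and **: "\<And>x. x \<in> C \<Longrightarrow> \<exists>y\<in>C. dist x y < 2 * \<rho> \<and> (\<forall>z\<in>C. dist y z < \<sigma> \<longrightarrow> z \<notin> P)"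
      unfolding holes_below_scale_def by (meson greaterThanLessThan_iff)
    obtain y where y: "y \<in> C" "dist x y < 2 * \<rho>" "\<And>z. z \<in> C \<Longrightarrow> dist y z < \<sigma> \<Longrightarrow> z \<notin> P"
      using **[OF x] by blast
    have "mball y \<sigma> \<subseteq> mball x (3 * \<rho>) - P"
    proof
      fix z assume "z \<in> mball y \<sigma>"
      then have "z \<in> C" "dist y z < \<sigma>" by auto
      then show "z \<in> mball x (3 * \<rho>) - P"
        using y(2) y(3)[of z] *(4) x dist_triangle[of x z y] by auto
    qed
    then show "\<exists>r\<in>{0<..<r'}. \<exists>s>0. c / 3 * r \<le> \<phi> s \<and> (\<exists>x'\<in>C. mball x' s \<subseteq> mball x r - P)"
      using * y(1) by (intro bexI[of _ "3 * \<rho>"] exI[of _ \<sigma>] conjI bexI[of _ y]) auto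
  qed (use assms in auto)
  then show ?thesis using P by (auto simp: upper_porous_def)
qed

text \<open>At each small distance \<open>R\<close> from \<open>f\<close> there is a
  \<open>g\<close> with a ball of maps that all have holes at one scale below
  \<open>\<delta>\<close>. Its radius \<open>\<sigma>\<close> has gauge \<open>c / Q * R\<close>,
  where \<open>c\<close> depends on \<open>\<delta>\<close>, whereas
  \<open>\<epsilon> / (10 * K)\<close> does not.\<close>

lemma lower_porous_without_holes:
  fixes C :: "'a::real_normed_vector set"
  assumes C: "convex C" "bounded C" "a \<in> C" "b \<in> C" "a \<noteq> b" and K: "K > 0" and \<eta>: "\<eta> > 0"
    and \<xi>: "strict_mono_on {0<..<\<eta>} \<xi>" "concave_on {0<..<\<eta>} \<xi>" "(\<xi> \<longlongrightarrow> 0) (at_right 0)"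
      "\<And>t. t \<in> {0<..<\<eta>} \<Longrightarrow> \<xi> t > 0"
    and \<phi>\<xi>: "\<And>t. t \<in> {0<..<\<eta>} \<Longrightarrow> t / K \<le> \<phi> t * \<xi> t"
    and \<epsilon>: "0 < \<epsilon>" "\<epsilon> \<le> 1" and \<delta>: "\<delta> > 0"
  shows "Metric_space.lower_porous (nonexpansive_maps C) (sup_dist C) \<xi>
    {f \<in> nonexpansive_maps C. \<not> holes_below_scale C \<phi> \<eta> (\<epsilon> / (10 * K)) \<delta> (flat_set C f \<epsilon>)}"
    (is "Metric_space.lower_porous ?M ?d \<xi> ?N")
proof -
  have ne: "C \<noteq> {}" using C by blast
  interpret Metric_space ?M ?d by (rule Metric_space_nonexpansive_maps[OF C(2) ne])
  obtain D where D: "\<And>x y. x \<in> C \<Longrightarrow> y \<in> C \<Longrightarrow> dist x y \<le> D"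
    using C(2) by (meson bounded_two_points)
  have D0: "0 < D" using D[OF C(3,4)] C(5) by (meson zero_less_dist_iff less_le_trans)
  \<comment> \<open>Cost in units of \<open>r\<close>: at most \<open>D + 2\<close> from
    \<open>f\<close> to \<open>g\<close>, as \<open>\<rho> \<le> 1\<close>, and 1 for the radius
    \<open>\<sigma> \<le> r\<close>.\<close>
  define Q where "Q = D + 3"
  define t0 where "t0 = \<eta> / 2"
  have t0: "t0 \<in> {0<..<\<eta>}" using \<eta> by (auto simp: t0_def)
  define A where "A = 2 * t0 / \<xi> t0"
  have A: "A > 0" using t0 \<xi>(4)[OF t0] by (simp add: A_def)
  define \<rho>0 where "\<rho>0 = min (\<delta> / 2) (min \<epsilon> (dist a b / 2))"
  have \<rho>0: "\<rho>0 > 0" using \<delta> \<epsilon> C by (simp add: \<rho>0_def)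
  \<comment> \<open>Since \<open>\<sigma> \<le> A * \<xi> \<sigma> = A * (c * r)\<close>, this bound
    forces \<open>\<rho> = 10 * \<sigma> / (\<epsilon> * r)\<close> to be at most
    \<open>\<rho>0\<close>.\<close>
  define c where "c = min 1 (\<epsilon> * \<rho>0 / (10 * A))"
  have c: "0 < c" "c \<le> 1" "10 * A * c \<le> \<epsilon> * \<rho>0"
    using A \<rho>0 \<epsilon> by (auto simp: c_def min_def field_simps)
  \<comment> \<open>The bounds give maps at exact distance \<open>R\<close>, then
    \<open>r < 1\<close>, and \<open>c * r\<close> among the values of \<open>\<xi>\<close> below
    \<open>t0\<close>.\<close>
  define R0 where "R0 = min (dist a b / 2) (min Q (\<xi> t0))"
  have R0: "R0 > 0" using C D0 \<xi>(4)[OF t0] by (simp add: R0_def Q_def)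
  have "lower_porous_at \<xi> ?N f" if f: "f \<in> ?M" for f
  proof (rule lower_porous_atI[OF \<xi>(1) \<eta> _ R0 f, where c = "c / Q"])
    show "c / Q > 0" using c D0 by (simp add: Q_def)
    show "\<exists>h\<in>?M. ?d f h = R" if "R \<in> {0<..<R0}" for R
      using that by (intro nonexpansive_maps_sphere_point[OF C(1-4) f]) (auto simp: R0_def)
    fix R assume R: "R \<in> {0<..<R0}"
    define r where "r = R / Q"
    have r: "0 < r" "r < 1" using R D0 by (auto simp: r_def R0_def Q_def)
    have "r \<le> R" using R D0 by (simp add: r_def Q_def divide_le_eq mult_le_cancel_left1)
    moreover have "c * r \<le> r" using c r by (intro mult_left_le_one_le) auto
    ultimately have "c * r < \<xi> t0" using R by (auto simp: R0_def)
    then obtain \<sigma> where \<sigma>: "0 < \<sigma>" "\<sigma> < t0" "\<xi> \<sigma> = c * r"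
      using concave_gauge_attains[OF \<xi>(2) t0 \<xi>(3), of "c * r"] c r by auto
    have \<sigma>\<eta>: "\<sigma> \<in> {0<..<\<eta>}" using \<sigma> t0 by auto
    \<comment> \<open>The gauge condition fixes \<open>\<sigma>\<close> first; this solves
      \<open>\<sigma> = \<epsilon> * (r * \<rho>) / 10\<close> for the spacing.\<close>
    define \<rho> where "\<rho> = 10 * \<sigma> / (\<epsilon> * r)"
    have \<sigma>_eq: "\<sigma> = \<epsilon> * (r * \<rho>) / 10" using \<epsilon> r by (simp add: \<rho>_def)
    have \<rho>_pos: "0 < \<rho>" using \<sigma> \<epsilon> r by (simp add: \<rho>_def)
    have "\<sigma> \<le> A * (c * r)"
      using concave_gauge_lower_bound[OF \<xi>(2,4) t0 \<sigma>(1,2)] \<sigma>(3) by (simp add: A_def)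
    then have "10 * \<sigma> \<le> (10 * A * c) * r" by simp
    also have "\<dots> \<le> \<epsilon> * \<rho>0 * r" using c(3) r by (intro mult_right_mono) auto
    finally have "\<rho> \<le> \<rho>0" using \<epsilon> r by (simp add: \<rho>_def divide_le_eq algebra_simps)
    then have \<rho>: "\<rho> \<le> \<epsilon>" "\<rho> \<le> dist a b / 2" "\<rho> < \<delta>" using \<delta> by (auto simp: \<rho>0_def)
    have "\<epsilon> * (r * \<rho>) \<le> r * \<rho>" "r * \<rho> \<le> \<rho>" "r * \<rho> \<le> r"
      using \<epsilon> r \<rho>_pos \<rho> by (auto intro!: mult_left_le_one_le mult_left_le)
    then have \<sigma>_le: "\<sigma> \<le> \<rho>" "\<sigma> \<le> r" using \<sigma>_eq \<sigma>(1) by linarith+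
    obtain g where g: "g \<in> ?M" "\<And>x. x \<in> C \<Longrightarrow> dist (f x) (g x) \<le> r * (D + 2 * \<rho>)"
      "\<And>h x. (\<And>x. x \<in> C \<Longrightarrow> dist (g x) (h x) < \<sigma>) \<Longrightarrow> x \<in> C \<Longrightarrow>
         \<exists>y\<in>C. dist x y < 2 * \<rho> \<and> (\<forall>z\<in>C. dist y z < \<sigma> \<longrightarrow> z \<notin> flat_set C h \<epsilon>)"
      using perturbation_with_holes[OF C(1,3,4) f D r \<rho>_pos \<rho>(1,2) \<epsilon>(2) \<sigma>_eq] by metis
    have "?d f g \<le> r * (D + 2 * \<rho>)" by (rule sup_dist_le[OF ne f g(1,2)])
    also have "\<dots> \<le> r * (D + 2)" using r \<rho> \<epsilon> by simp
    finally have "?d f g + \<sigma> \<le> r * Q" using \<sigma>_le by (simp add: Q_def algebra_simps)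
    also have "r * Q = R" using D0 by (simp add: r_def Q_def)
    finally have fg: "?d f g + \<sigma> \<le> R" .
    \<comment> \<open>The gauge inequality gives
      \<open>\<phi> \<sigma> \<ge> \<sigma> / (K * (c * r))\<close>; dropping
      \<open>c \<le> 1\<close> frees the constant from \<open>\<delta>\<close>.\<close>
    have "\<epsilon> / (10 * K) * \<rho> = \<sigma> / (K * r)" using \<epsilon> r by (simp add: \<rho>_def)
    also have "\<dots> \<le> \<sigma> / (K * (c * r))"
      using \<sigma> K c r by (intro divide_left_mono) (auto simp: mult_left_le_one_le)
    also have "\<dots> \<le> \<phi> \<sigma>"
      using \<phi>\<xi>[OF \<sigma>\<eta>] \<sigma>(3) K c r by (simp add: field_simps)
    finally have \<phi>\<sigma>: "\<epsilon> / (10 * K) * \<rho> \<le> \<phi> \<sigma>" .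
    have "mball g \<sigma> \<subseteq> mball f R - ?N"
    proof
      fix h assume "h \<in> mball g \<sigma>"
      then have h: "h \<in> ?M" "?d g h < \<sigma>" by auto
      have "h \<in> mball f R"
        using triangle[OF f g(1) h(1)] h fg f by auto
      moreover have "dist (g x) (h x) < \<sigma>" if "x \<in> C" for x
        using dist_le_sup_dist[OF C(2) g(1) h(1) that] h(2) by linarith
      then have "holes_below_scale C \<phi> \<eta> (\<epsilon> / (10 * K)) \<delta> (flat_set C h \<epsilon>)"
        unfolding holes_below_scale_def using g(3)[of h] \<rho>_pos \<rho>(3) \<sigma>\<eta> \<sigma>_le \<phi>\<sigma>
        by (intro bexI[of _ \<rho>] bexI[of _ \<sigma>] conjI ballI) auto
      ultimately show "h \<in> mball f R - ?N" by blast
    qed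
    then show "\<exists>s>0. c / Q * R \<le> \<xi> s \<and> (\<exists>x'\<in>?M. mball x' s \<subseteq> mball f R - ?N)"
      using g(1) \<sigma> by (intro exI[of _ \<sigma>] conjI bexI[of _ g]) (auto simp: r_def)
  qed
  then show ?thesis by (auto simp: lower_porous_def)
qed

theorem theorem1p3:
  fixes C :: "'a::banach set"
    and K :: real
    and \<phi> \<xi> :: "real \<Rightarrow> real"
  assumes "closed C" and "bounded C" and "convex C"
    and "C \<noteq> {}" and "\<nexists>x. C = {x}"
    and "K > 1"
    and "\<And>t. t \<in> {0<..<1/K} \<Longrightarrow> \<phi> t > 0"
    and "\<And>t. t \<in> {0<..<1/K} \<Longrightarrow> \<xi> t > 0"
    and "strict_mono_on {0<..<1/K} \<phi>" and "strict_mono_on {0<..<1/K} \<xi>"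
    and "concave_on {0<..<1/K} \<phi>" and "concave_on {0<..<1/K} \<xi>"
    and "\<And>t. t \<in> {0<..<1/K} \<Longrightarrow> \<phi> t * \<xi> t \<ge> t / K"
    and "(\<xi> \<longlongrightarrow> 0) (at_right 0)"
  shows "\<exists>N \<subseteq> nonexpansive_maps C.
           Metric_space.sigma_lower_porous (nonexpansive_maps C) (sup_dist C) \<xi> N \<and>
           (\<forall>f \<in> nonexpansive_maps C - N.
              \<exists>P \<subseteq> C. Metric_space.sigma_upper_porous C dist \<phi> P \<and> Lip_one_set C f = C - P)"
proof -
  let ?M = "nonexpansive_maps C"
  interpret M: Metric_space ?M "sup_dist C"
    by (rule Metric_space_nonexpansive_maps) fact+
  interpret C: Metric_space C dist by (rule Metric_space_subset)
  obtain a b where ab: "a \<in> C" "b \<in> C" "a \<noteq> b"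
    using assms(4,5) by blast
  have K: "0 < K" "0 < 1 / K" using \<open>K > 1\<close> by auto
  define holes where "holes n \<delta> f \<longleftrightarrow>
    holes_below_scale C \<phi> (1 / K) (1 / Suc n / (10 * K)) \<delta> (flat_set C f (1 / Suc n))" for n :: nat and \<delta> f
  \<comment> \<open>\<open>n\<close> sets the flatness and \<open>m\<close> the scale bound. A map
    outside every \<open>N n m\<close> has, for each \<open>n\<close>, holes below all scales with
    the same constant.\<close>
  define N where "N n m = {f \<in> ?M. \<not> holes n (1 / Suc m) f}" for n m :: nat
  have "M.lower_porous \<xi> (N n m)" for n m
    unfolding N_def holes_def using assms ab K by (intro lower_porous_without_holes[of C a b]) auto
  then have "M.sigma_lower_porous \<xi> (\<Union>n. \<Union>m. N n m)"
    unfolding M.sigma_lower_porous_def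
    by (intro exI[of _ "range (\<lambda>(n, m). N n m)"]) auto
  moreover have "\<exists>P\<subseteq>C. C.sigma_upper_porous \<phi> P \<and> Lip_one_set C f = C - P"
    if f: "f \<in> ?M - (\<Union>n. \<Union>m. N n m)" for f
  proof -
    let ?P = "\<lambda>n::nat. flat_set C f (1 / Suc n)"
    have PC: "?P n \<subseteq> C" for n by (auto simp: flat_set_def)
    have "C.upper_porous \<phi> (?P n)" for n
    proof (rule upper_porous_of_holes[OF \<open>convex C\<close> ab assms(9) K(2) _ PC])
      show "0 < 1 / Suc n / (10 * K)" using K by simp
      fix \<delta> :: real assume "\<delta> > 0"
      then obtain m where "inverse (real (Suc m)) < \<delta>" using reals_Archimedean by blast
      then have m: "1 / real (Suc m) \<le> \<delta>" by (simp add: inverse_eq_divide)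
      have "holes n (1 / Suc m) f" using f by (auto simp: N_def)
      then show "holes_below_scale C \<phi> (1 / K) (1 / Suc n / (10 * K)) \<delta> (?P n)"
        unfolding holes_def by (rule holes_below_scale_mono[OF _ m])
    qed
    then have "C.sigma_upper_porous \<phi> (\<Union>n. ?P n)"
      unfolding C.sigma_upper_porous_def by (intro exI[of _ "range ?P"]) auto
    moreover have "Lip_one_set C f = C - (\<Union>n. ?P n)"
      using Lip_at_eq_1_iff[of f C] f by (auto simp: Lip_one_set_def)
    ultimately show ?thesis using PC by (intro exI[of _ "\<Union>n. ?P n"]) blast
  qed
  moreover have "(\<Union>n. \<Union>m. N n m) \<subseteq> ?M" by (auto simp: N_def)
  ultimately show ?thesis by blast
qed

end
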